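(* For all integers $c,L\geqslant 2$ and $M\geqslant 1$, one has $$W(\mathcal{B}(c,L),M)\leqslant (R+1)\,L^{k\,c!},$$ where $k=\lceil\log_L M\rceil$ and $R=2L^{c^4-2c^2+3}-L$.
   Context: $\mathbb{N}=\mathbb{Z}_{\geqslant 0}$. A substitution on a finite alphabet $\mathcal{A}$ is a map $\varrho\colon\mathcal{A}\to\mathcal{A}^+$, extended to words by concatenation. It has constant length $L$ if $|\varrho(a)|=L$ for all $a$; its $i$-th column ($0\leqslant i\leqslant L-1$) is the map $\varrho_i\colon\mathcal{A}\to\mathcal{A}$ sending $a$ to the $i$-th letter of $\varrho(a)$ (indices from $0$). It is bijective if every column is a bijection. It is primitive if some power $\varrho^n$ is such that every $\varrho^n(a)$ contains all letters. A fixed point is $w\in\mathcal{A}^{\mathbb{N}}$ with $\varrho(w)=w$; $\varrho$ is aperiodic if it has no fixed point of the form $v^\infty$ with $v$ a finite word. $\mathcal{B}(c,L)$ is the set of all one-sided fixed points of substitutions $\varrho$ of constant length $L$ on a $c$-letter alphabet that are aperiodic, primitive, bijective and satisfy $\varrho_0=\mathrm{id}$. A (finite or infinite) word $x$ contains a monochromatic arithmetic progression of length $M$ if there are a start $j\geqslant0$ and a difference $d\geqslant1$ such that the positions $j,j+d,\dots,j+(M-1)d$ all lie in $x$ and carry the same letter. $W(\mathcal{B}(c,L),M)$ denotes the smallest positive integer $n$ such that every length-$n$ subword (block of $n$ consecutive letters) of every element of $\mathcal{B}(c,L)$ contains a monochromatic arithmetic progression of length $M$ (such $n$ exists by van der Waerden's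 theorem). *)

theory Defs
  imports Complex_Main "HOL-Library.Stream"
begin

text \<open>
  Finite words are lists, one-sided infinite words are streams. Alphabets are explicit
  carrier sets; the values of a substitution outside its alphabet are irrelevant.
\<close>

definition substitution_on :: "'a set \<Rightarrow> ('a \<Rightarrow> 'a list) \<Rightarrow> bool" where
  "substitution_on A \<rho> \<longleftrightarrow> (\<forall>a\<in>A. \<rho> a \<noteq> [] \<and> \<rho> a \<in> lists A)"

definition subst_word :: "('a \<Rightarrow> 'a list) \<Rightarrow> 'a list \<Rightarrow> 'a list" where
  "subst_word \<rho> u = concat (map \<rho> u)"

definition subst_stream :: "('a \<Rightarrow> 'a list) \<Rightarrow> 'a stream \<Rightarrow> 'a stream" where
  "subst_stream \<rho> w = flat (smap \<rho> w)"

definition constant_length :: "'a set \<Rightarrow> ('a \<Rightarrow> 'a list) \<Rightarrow> nat \<Rightarrow> bool" where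
  "constant_length A \<rho> L \<longleftrightarrow> (\<forall>a\<in>A. length (\<rho> a) = L)"

definition column :: "('a \<Rightarrow> 'a list) \<Rightarrow> nat \<Rightarrow> 'a \<Rightarrow> 'a" where
  "column \<rho> i a = \<rho> a ! i"

definition bijective_subst :: "'a set \<Rightarrow> ('a \<Rightarrow> 'a list) \<Rightarrow> nat \<Rightarrow> bool" where
  "bijective_subst A \<rho> L \<longleftrightarrow> (\<forall>i<L. bij_betw (column \<rho> i) A A)"

definition primitive_subst :: "'a set \<Rightarrow> ('a \<Rightarrow> 'a list) \<Rightarrow> bool" where
  "primitive_subst A \<rho> \<longleftrightarrow> (\<exists>n\<ge>1. \<forall>a\<in>A. A \<subseteq> set ((subst_word \<rho> ^^ n) [a]))"

definition fixed_point :: "'a set \<Rightarrow> ('a \<Rightarrow> 'a list) \<Rightarrow> 'a stream \<Rightarrow> bool" where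
  "fixed_point A \<rho> w \<longleftrightarrow> w \<in> streams A \<and> subst_stream \<rho> w = w"

definition aperiodic_subst :: "'a set \<Rightarrow> ('a \<Rightarrow> 'a list) \<Rightarrow> bool" where
  "aperiodic_subst A \<rho> \<longleftrightarrow> \<not> (\<exists>v. v \<noteq> [] \<and> fixed_point A \<rho> (cycle v))"

text \<open>
  The letters are taken to be natural numbers, which loses no generality since all the
  notions involved are invariant under renaming of letters; every \<open>c\<close>-element set of naturals
  is admitted as an alphabet.
\<close>

definition fixed_points_B :: "nat \<Rightarrow> nat \<Rightarrow> nat stream set" where
  "fixed_points_B c L = {w. \<exists>A \<rho>. finite A \<and> card A = c \<and>
     substitution_on A \<rho> \<and> constant_length A \<rho> L \<and>
     aperiodic_subst A \<rho> \<and> primitive_subst A \<rho> \<and> bijective_subst A \<rho> L \<and>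
     (\<forall>a\<in>A. column \<rho> 0 a = a) \<and>
     fixed_point A \<rho> w}"

definition has_mono_AP :: "'a list \<Rightarrow> nat \<Rightarrow> bool" where
  "has_mono_AP x M \<longleftrightarrow>
     (\<exists>j d. d \<ge> 1 \<and> (\<forall>i<M. j + i * d < length x \<and> x ! (j + i * d) = x ! j))"

definition W :: "'a stream set \<Rightarrow> nat \<Rightarrow> nat" where
  "W X M = (LEAST n. n \<ge> 1 \<and> (\<forall>w\<in>X. \<forall>m. has_mono_AP (stake n (sdrop m w)) M))"

end

(* Put Q = L^k, t = c! and d = 1 + Q + ... + Q^(t-1). For j < Q the base-Q expansion of j d consists
   of t digits j, so the column of the kt-th power of the substitution at position j d is the t-th
   power of a permutation of c letters, hence the identity. Every block of length Q^t = L^(k c!) of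
   the fixed point that is the image of one letter therefore contains a monochromatic arithmetic
   progression of length Q \<ge> M, and any window of length 2 Q^t contains such a block. *)
theory Submission
  imports Defs
begin

lemma flat_snth_const_length:
  assumes "\<And>n. length (s !! n) = L" and "i < L"
  shows "flat s !! (L * n + i) = (s !! n) ! i"
  using assms(1)
proof (induction n arbitrary: s)
  case (0 s)
  have len: "length (shd s) = L" using 0[of 0] by simp
  hence "shd s \<noteq> []" using \<open>i < L\<close> by auto
  then show ?case using len \<open>i < L\<close> by (simp add: flat_unfold)
next
  case (Suc n s)
  have len: "length (shd s) = L" using Suc.prems[of 0] by simp
  hence "shd s \<noteq> []" using \<open>i < L\<close> by auto
  hence "flat s !! (L * Suc n + i) = flat (stl s) !! (L * n + i)"
    using len by (simp add: flat_unfold add.assoc)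
  also have "\<dots> = (stl s !! n) ! i"
    using Suc.prems[of "Suc _"] by (intro Suc.IH) simp
  finally show ?case by simp
qed

lemma fixed_point_snth:
  assumes "fixed_point A \<rho> w" and "constant_length A \<rho> L" and "i < L"
  shows "w !! (L * n + i) = column \<rho> i (w !! n)"
proof -
  have "w !! n \<in> A" for n
    using assms(1) snth_sset[of w n] streams_iff_sset[of w A] unfolding fixed_point_def by auto
  hence "flat (smap \<rho> w) !! (L * n + i) = (smap \<rho> w !! n) ! i"
    using assms(2,3) by (intro flat_snth_const_length) (auto simp: constant_length_def)
  then show ?thesis
    using assms(1) by (simp add: fixed_point_def subst_stream_def column_def)
qed

text \<open>The least significant base-\<open>L\<close> digit of \<open>j\<close> selects the column
  applied last, and \<open>j div L\<close> is the position one level up. So \<open>f\<close> is a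
  composition of \<open>k\<close> columns chosen by the digits of \<open>j\<close> alone, and the
  same \<open>f\<close> serves every \<open>n\<close>.\<close>

lemma fixed_point_power_column:
  assumes "fixed_point A \<rho> w" and "constant_length A \<rho> L" and "bijective_subst A \<rho> L"
    and "L > 0" and "j < L ^ k"
  shows "\<exists>f. bij_betw f A A \<and> (\<forall>n. w !! (L ^ k * n + j) = f (w !! n))"
  using \<open>j < L ^ k\<close>
proof (induction k arbitrary: j)
  case 0
  then show ?case by (intro exI[of _ id] conjI bij_betw_id) simp
next
  case (Suc k)
  have "j div L < L ^ k"
    using Suc.prems by (simp add: less_mult_imp_div_less mult.commute)
  then obtain f where f: "bij_betw f A A" "\<And>n. w !! (L ^ k * n + j div L) = f (w !! n)"
    using Suc.IH by blast
  have lt: "j mod L < L" using \<open>L > 0\<close> by simp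
  have "L ^ Suc k * n + j = L * (L ^ k * n + j div L) + j mod L" for n
    by (simp add: distrib_left mult.assoc)
  hence "w !! (L ^ Suc k * n + j) = (column \<rho> (j mod L) \<circ> f) (w !! n)" for n
    using fixed_point_snth[OF assms(1,2) lt] f(2) by simp
  moreover have "bij_betw (column \<rho> (j mod L) \<circ> f) A A"
    using f(1) assms(3) lt unfolding bijective_subst_def by (blast intro: bij_betw_trans)
  ultimately show ?case by blast
qed

lemma snth_repeated_digit:
  fixes Q :: nat
  assumes "\<And>n. w !! (Q * n + j) = f (w !! n)"
  shows "w !! (Q ^ t * n + j * (\<Sum>i<t. Q ^ i)) = (f ^^ t) (w !! n)"
proof (induction t)
  case (Suc t)
  \<comment> \<open>Shifting the sum splits off the lowest digit \<open>j\<close>, which contributes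
    the outermost \<open>f\<close>.\<close>
  have "Q ^ Suc t * n + j * (\<Sum>i<Suc t. Q ^ i) = Q * (Q ^ t * n + j * (\<Sum>i<t. Q ^ i)) + j"
    by (subst sum.lessThan_Suc_shift) (simp add: algebra_simps sum_distrib_left)
  then show ?case using assms Suc by simp
qed simp

text \<open>Keeps the whole progression inside one block of length \<open>Q ^ t\<close>.\<close>

lemma repeated_digit_less:
  fixes Q :: nat
  assumes "j < Q"
  shows "j * (\<Sum>i<t. Q ^ i) < Q ^ t"
proof (induction t)
  case (Suc t)
  have "j * (\<Sum>i<Suc t. Q ^ i) = j * (\<Sum>i<t. Q ^ i) + j * Q ^ t"
    by (simp add: algebra_simps)
  also have "\<dots> < Suc j * Q ^ t" using Suc by simp
  also have "\<dots> \<le> Q ^ Suc t" using assms by (simp add: mult_le_mono1 del: mult_Suc)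
  finally show ?case .
qed simp

text \<open>By pigeonhole the orbit of \<open>a\<close> repeats within \<open>card A\<close> steps;
  bijectivity makes it return to \<open>a\<close> itself, and a period of at most
  \<open>card A\<close> divides the factorial.\<close>

lemma funpow_fact_card:
  assumes "finite A" and "bij_betw f A A" and "a \<in> A"
  shows "(f ^^ fact (card A)) a = a"
proof -
  have bij: "bij_betw (f ^^ n) A A" for n
  proof (induction n)
    case (Suc n)
    then show ?case using bij_betw_trans[OF Suc assms(2)] by (simp only: funpow.simps)
  qed (simp only: funpow.simps bij_betw_id)
  let ?g = "\<lambda>n. (f ^^ n) a"
  have "?g ` {..card A} \<subseteq> A" using bij assms(3) by (auto dest: bij_betwE)
  hence "card (?g ` {..card A}) < card {..card A}"
    using card_mono[OF assms(1)] by (simp add: less_Suc_eq_le)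
  hence "\<not> inj_on ?g {..card A}" by (rule pigeonhole)
  then obtain i j where ij: "i < j" "j \<le> card A" "?g i = ?g j"
    unfolding inj_on_def by (metis atMost_iff linorder_neqE_nat)
  have "(f ^^ i) ((f ^^ (j - i)) a) = (f ^^ i) a"
    using ij by (simp flip: funpow_add[THEN fun_cong, unfolded comp_apply])
  hence per: "(f ^^ (j - i)) a = a"
    using bij_betw_imp_inj_on[OF bij[of i]] bij_betwE[OF bij] assms(3) by (meson inj_onD)
  have "(j - i) dvd fact (card A)" using ij by (intro dvd_fact) auto
  then obtain r where r: "fact (card A) = (j - i) * r" by (elim dvdE)
  have "((f ^^ (j - i)) ^^ r) a = a" by (induction r) (simp_all add: per)
  then show ?thesis by (simp add: r funpow_mult mult.commute)
qed

theorem proposition21: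
  fixes c L M :: nat
  assumes "c \<ge> 2" and "L \<ge> 2" and "M \<ge> 1"
  shows "W (fixed_points_B c L) M \<le>
    (let k = nat \<lceil>log (real L) (real M)\<rceil>;
         R = 2 * L ^ (c ^ 4 - 2 * c ^ 2 + 3) - L
     in (R + 1) * L ^ (k * fact c))"
proof -
  define k where "k = nat \<lceil>log (real L) (real M)\<rceil>"
  define R where "R = 2 * L ^ (c ^ 4 - 2 * c ^ 2 + 3) - L"
  define Q where "Q = L ^ k"
  define N where "N = Q ^ fact c"
  define d where "d = (\<Sum>i<fact c. Q ^ i)"
  \<comment> \<open>Truncated subtraction is harmless here: the exponent is at least 3 because the 3
    is added last. \<open>R \<ge> 1\<close> makes the window at least \<open>2 * N\<close>
    long.\<close>
  have "L ^ 1 \<le> L ^ (c ^ 4 - 2 * c ^ 2 + 3)"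
    using assms(2) by (intro power_increasing) auto
  hence R: "R \<ge> 1" using assms(2) unfolding R_def by simp
  have "N > 0" using assms(2) by (simp add: N_def Q_def)
  have "real M = real L powr log (real L) (real M)" using assms by simp
  also have "\<dots> \<le> real L powr real k"
    using assms(2) by (intro powr_mono) (auto simp: k_def of_nat_ceiling)
  also have "\<dots> = real Q" using assms(2) by (simp add: Q_def powr_realpow)
  finally have MQ: "M \<le> Q" by simp
  have "Q ^ 0 \<le> d" unfolding d_def by (rule member_le_sum) auto
  hence d1: "d \<ge> 1" by simp
  have AP: "has_mono_AP (stake ((R + 1) * N) (sdrop m w)) M"
    if w: "w \<in> fixed_points_B c L" for w m
  proof -
    obtain A \<rho> where A: "finite A" "card A = c" and len: "constant_length A \<rho> L"
      and bij: "bijective_subst A \<rho> L" and fp: "fixed_point A \<rho> w"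
      using w unfolding fixed_points_B_def by blast
    have wA: "w !! n \<in> A" for n
      using fp snth_sset[of w n] streams_iff_sset[of w A] unfolding fixed_point_def by auto
    \<comment> \<open>The permutation \<open>f\<close> varies with \<open>j\<close>, but the
      exponent \<open>fact c\<close> trivialises all of them at once, so these positions share one
      letter.\<close>
    have block: "w !! (N * n + j * d) = w !! n" if "j < Q" for n j
    proof -
      have "L > 0" using assms(2) by simp
      then obtain f where f: "bij_betw f A A" "\<And>n. w !! (Q * n + j) = f (w !! n)"
        using fixed_point_power_column[OF fp len bij] \<open>j < Q\<close> unfolding Q_def by blast
      show ?thesis
        using snth_repeated_digit[of w Q j f, OF f(2)] funpow_fact_card[OF A(1) f(1) wA] A(2)
        by (simp add: N_def d_def)
    qed
    \<comment> \<open>Block \<open>q\<close> is the first one starting strictly after position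
      \<open>m\<close>. It starts at most \<open>N\<close> letters later, so it ends within
      \<open>2 * N\<close> letters of \<open>m\<close>.\<close>
    define q where "q = m div N + 1"
    have "N * (m div N) + m mod N = m" by simp
    moreover have "m mod N < N" using \<open>N > 0\<close> by simp
    moreover have "N * q = N * (m div N) + N" by (simp add: q_def)
    ultimately have q: "m \<le> N * q" "N * q \<le> m + N" by linarith+
    have "2 * N \<le> (R + 1) * N" using R by (intro mult_le_mono1) simp
    hence pos: "N * q - m + i * d < (R + 1) * N" if "i < Q" for i
      using repeated_digit_less[OF that, of "fact c"] q unfolding N_def[symmetric] d_def[symmetric]
      by linarith
    have val: "stake ((R + 1) * N) (sdrop m w) ! (N * q - m + i * d) = w !! q" if "i < Q" for i
    proof -
      have "m + (N * q - m + i * d) = N * q + i * d" using q by simp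
      then show ?thesis using pos[OF that] block[OF that, of q]
        by (simp add: stake_nth sdrop_snth del: add_mult_distrib mult_Suc)
    qed
    \<comment> \<open>The index 0 is needed because \<open>has_mono_AP\<close> compares every term
      with the starting one; the first \<open>M\<close> of the \<open>Q\<close> available terms are
      taken.\<close>
    have "0 < Q" using MQ assms(3) by simp
    then show ?thesis
      unfolding has_mono_AP_def using d1 pos val val[of 0] MQ
      by (intro exI[of _ "N * q - m"] exI[of _ d]) auto
  qed
  have "W (fixed_points_B c L) M \<le> (R + 1) * N"
    unfolding W_def using AP \<open>N > 0\<close> by (intro Least_le) (auto simp: Suc_le_eq)
  then show ?thesis
    by (simp add: Let_def k_def R_def N_def Q_def power_mult)
qed

end
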